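(* Let $(X,\mathcal{G},\gamma)$ be a normal decomposition system. Let $\Omega$ be a convex $\mathcal{G}$-invariant set in $X$, let $F:X\to\mathbb{R}$ be a convex $\mathcal{G}$-invariant function, and let $\Theta:X\to\mathbb{R}$ be Fréchet differentiable. Suppose that $a\in\Omega$ is a local minimizer of $$\min_{x\in\Omega}\ \Theta(x)+F(x).$$ Then $-\Theta'(a)$ and $a$ commute in $(X,\mathcal{G},\gamma)$.
   Context: A normal decomposition system is a triple $(X,\mathcal{G},\gamma)$ where $X$ is a real inner product space, $\mathcal{G}$ is a closed subgroup of the orthogonal group of $X$, and $\gamma:X\to X$ is a map such that: (a) $\gamma(Ax)=\gamma(x)$ for all $x\in X$, $A\in\mathcal{G}$; (b) for each $x\in X$ there exists $A\in\mathcal{G}$ with $x=A\gamma(x)$; (c) $\langle x,w\rangle\le\langle\gamma(x),\gamma(w)\rangle$ for all $x,w\in X$. A set $\Omega\subseteq X$ is $\mathcal{G}$-invariant if $A(\Omega)\subseteq\Omega$ for all $A\in\mathcal{G}$; a function $F:X\to\mathbb{R}$ is $\mathcal{G}$-invariant if $F(Ax)=F(x)$ for all $x\in X$, $A\in\mathcal{G}$. Elements $x,w\in X$ commute in $(X,\mathcal{G},\gamma)$ if there exists $A\in\mathcal{G}$ such that $x=A\gamma(x)$ and $w=A\gamma(w)$. The Fréchet derivative $\Theta'(a)$ is regarded as the element of $X$ representing it through the inner product: the derivative of $\Theta$ at $a$ in direction $h$ is $\langle\Theta'(a),h\rangle$. A local minimizer is a point $a\in\Omega$ having a neighborhood $N_a$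 such that $\Theta(a)+F(a)\le\Theta(x)+F(x)$ for all $x\in N_a\cap\Omega$. *)

theory Defs
  imports "HOL-Analysis.Analysis" "HOL-Algebra.Group"
begin

(* Inner product preservation alone does not give surjectivity in infinite dimension,
   hence the extra condition. *)
definition orthogonal_group :: "('a::real_inner \<Rightarrow>\<^sub>L 'a) monoid" where
  "orthogonal_group =
    \<lparr>carrier = {A. orthogonal_transformation (blinfun_apply A) \<and> surj (blinfun_apply A)},
     mult = (o\<^sub>L), one = id_blinfun\<rparr>"

lemma group_orthogonal_group: "group (orthogonal_group :: ('a::real_inner \<Rightarrow>\<^sub>L 'a) monoid)"
proof (rule groupI)
  fix A :: "'a \<Rightarrow>\<^sub>L 'a"
  assume "A \<in> carrier orthogonal_group"
  then have A: "orthogonal_transformation (blinfun_apply A)" "surj (blinfun_apply A)"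
    by (auto simp: orthogonal_group_def)
  let ?f = "blinfun_apply A"
  let ?g = "inv_into UNIV ?f"
  have "inj ?f"
    by (rule orthogonal_transformation_inj[OF A(1)])
  then have gf: "\<And>x. ?g (?f x) = x" and fg: "\<And>x. ?f (?g x) = x"
    using A(2) by (simp_all add: surj_f_inv_f)
  have "linear ?g"
  proof (rule linearI)
    show "?g (x + y) = ?g x + ?g y" for x y
      by (metis fg gf blinfun.add_right)
    show "?g (c *\<^sub>R x) = c *\<^sub>R ?g x" for c x
      by (metis fg gf blinfun.scaleR_right)
  qed
  then have g: "orthogonal_transformation ?g"
    using A(1) fg unfolding orthogonal_transformation_def by metis
  then have "bounded_linear ?g"
    using \<open>linear ?g\<close>
    by (auto simp: bounded_linear_def bounded_linear_axioms_def orthogonal_transformation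
        linear_linear intro!: exI[of _ 1])
  then have app: "blinfun_apply (Blinfun ?g) = ?g"
    by (rule bounded_linear_Blinfun_apply)
  show "\<exists>B\<in>carrier orthogonal_group. B \<otimes>\<^bsub>orthogonal_group\<^esub> A = \<one>\<^bsub>orthogonal_group\<^esub>"
  proof (rule bexI[of _ "Blinfun ?g"])
    show "Blinfun ?g \<otimes>\<^bsub>orthogonal_group\<^esub> A = \<one>\<^bsub>orthogonal_group\<^esub>"
      by (rule blinfun_eqI) (simp add: orthogonal_group_def app gf)
    have "surj ?g"
      using gf by (rule surjI)
    then show "Blinfun ?g \<in> carrier orthogonal_group"
      using g by (simp add: orthogonal_group_def app)
  qed
qed (auto simp: orthogonal_group_def orthogonal_transformation_def linear_iff surj_def
      blinfun.add_right blinfun.scaleR_right intro!: blinfun_eqI, metis)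

(* Closedness is relative to the orthogonal group in the operator norm topology; for complete X
   this is the same as closedness among all bounded operators. *)
locale normal_decomposition_system =
  fixes G :: "('a::real_inner \<Rightarrow>\<^sub>L 'a) set" and \<gamma> :: "'a \<Rightarrow> 'a"
  assumes subgroup_orthogonal: "subgroup G orthogonal_group"
    and closed_orthogonal: "closedin (top_of_set (carrier orthogonal_group)) G"
    and gamma_invariant: "A \<in> G \<Longrightarrow> \<gamma> (blinfun_apply A x) = \<gamma> x"
    and gamma_decomposition: "\<exists>A\<in>G. x = blinfun_apply A (\<gamma> x)"
    and gamma_inner: "x \<bullet> w \<le> \<gamma> x \<bullet> \<gamma> w"

definition invariant_set :: "('a::real_normed_vector \<Rightarrow>\<^sub>L 'a) set \<Rightarrow> 'a set \<Rightarrow> bool" where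
  "invariant_set G \<Omega> \<longleftrightarrow> (\<forall>A\<in>G. blinfun_apply A ` \<Omega> \<subseteq> \<Omega>)"

definition invariant_fun :: "('a::real_normed_vector \<Rightarrow>\<^sub>L 'a) set \<Rightarrow> ('a \<Rightarrow> real) \<Rightarrow> bool" where
  "invariant_fun G F \<longleftrightarrow> (\<forall>A\<in>G. \<forall>x. F (blinfun_apply A x) = F x)"

definition commute_in ::
  "('a::real_normed_vector \<Rightarrow>\<^sub>L 'a) set \<Rightarrow> ('a \<Rightarrow> 'a) \<Rightarrow> 'a \<Rightarrow> 'a \<Rightarrow> bool" where
  "commute_in G \<gamma> x w \<longleftrightarrow>
    (\<exists>A\<in>G. x = blinfun_apply A (\<gamma> x) \<and> w = blinfun_apply A (\<gamma> w))"

definition local_minimizer_on :: "'a::topological_space set \<Rightarrow> ('a \<Rightarrow> real) \<Rightarrow> 'a \<Rightarrow> bool" where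
  "local_minimizer_on \<Omega> f a \<longleftrightarrow>
    a \<in> \<Omega> \<and> (\<exists>N. open N \<and> a \<in> N \<and> (\<forall>x\<in>N \<inter> \<Omega>. f a \<le> f x))"

end

theory Submission
  imports Defs
begin

text \<open>
  Moving from \<open>a\<close> towards \<open>B a\<close>, for \<open>B\<close> in the group, stays in \<open>\<Omega>\<close> and does not increase \<open>F\<close>, so
  the derivative of \<open>\<Theta>\<close> in the direction \<open>B a - a\<close> is nonnegative. Hence \<open>a\<close> maximizes the inner
  product with \<open>- \<Theta>'(a)\<close> over its orbit; by the decomposition axiom this maximum is
  \<open>\<gamma> (- \<Theta>'(a)) \<bullet> \<gamma> a\<close>. Finally, equality in the axiom \<open>x \<bullet> w \<le> \<gamma> x \<bullet> \<gamma> w\<close> forces \<open>x\<close> and \<open>w\<close> to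
  commute: an \<open>A\<close> that decomposes \<open>x + w\<close> decomposes both \<open>x\<close> and \<open>w\<close>.
\<close>

text \<open>Equality case of Cauchy-Schwarz: the hypotheses make the squared norm of
  \<open>x - y\<close>, namely \<open>2 * (x \<bullet> x - x \<bullet> y)\<close>,
  nonpositive.\<close>

lemma eq_if_inner_ge:
  fixes x y :: "'a::real_inner"
  assumes "x \<bullet> x = y \<bullet> y" and "x \<bullet> x \<le> x \<bullet> y"
  shows "x = y"
proof -
  have "(x - y) \<bullet> (x - y) \<le> 0"
    using assms by (simp add: inner_diff inner_commute)
  then show ?thesis
    by (metis inner_gt_zero_iff not_le right_minus_eq)
qed

lemma GDERIV_nonneg_if_local_min_on_segment:
  fixes f :: "'a::real_inner \<Rightarrow> real"
  assumes "GDERIV f a :> D" and "open N" and "a \<in> N"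
    and min: "\<And>t. 0 < t \<Longrightarrow> t \<le> 1 \<Longrightarrow> a + t *\<^sub>R d \<in> N \<Longrightarrow> f a \<le> f (a + t *\<^sub>R d)"
  shows "0 \<le> D \<bullet> d"
proof (rule ccontr)
  assume neg: "\<not> 0 \<le> D \<bullet> d"
  let ?g = "\<lambda>t. f (a + t *\<^sub>R d)"
  \<comment> \<open>The base point is written with \<open>0 *\<^sub>R d\<close> so that it matches
    the value of the segment map at 0 in the chain rule.\<close>
  have "(f has_derivative (\<lambda>h. h \<bullet> D)) (at (a + 0 *\<^sub>R d))"
    using assms(1) by (simp add: gderiv_def)
  then have "(?g has_derivative (\<lambda>t. (t *\<^sub>R d) \<bullet> D)) (at 0)"
    by (rule has_derivative_compose[rotated]) (auto intro!: derivative_eq_intros)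
  then have "(?g has_real_derivative D \<bullet> d) (at 0)"
    by (simp add: has_field_derivative_def inner_commute mult_commute_abs)
  then obtain e where e: "e > 0" "\<And>h. 0 < h \<Longrightarrow> h < e \<Longrightarrow> ?g h < ?g 0"
    using DERIV_neg_dec_right[of ?g "D \<bullet> d" 0] neg by auto
  have "((\<lambda>t. a + t *\<^sub>R d) \<longlongrightarrow> a + 0 *\<^sub>R d) (at_right 0)"
    by (intro tendsto_intros)
  then have "\<forall>\<^sub>F t in at_right 0. a + t *\<^sub>R d \<in> N"
    using topological_tendstoD assms(2,3) by fastforce
  moreover have "\<forall>\<^sub>F t in at_right 0. t \<in> {0<..<min e 1}"
    using e(1) by (intro eventually_at_right_real) simp
  \<comment> \<open>A small positive \<open>t\<close> would satisfy both the strict decrease and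
    \<open>min\<close>; the filter \<open>at_right 0\<close> is nontrivial, so this is
    absurd.\<close>
  ultimately have "\<forall>\<^sub>F t in at_right (0::real). False"
  proof eventually_elim
    case (elim t)
    then show ?case
      using e(2)[of t] min[of t] by simp
  qed
  then show False
    by simp
qed

context normal_decomposition_system
begin

lemma inner_blinfun_apply:
  assumes "A \<in> G"
  shows "blinfun_apply A x \<bullet> blinfun_apply A y = x \<bullet> y"
  using assms subgroup.subset[OF subgroup_orthogonal]
  by (auto simp: orthogonal_group_def orthogonal_transformation_def)

lemma gamma_idem: "\<gamma> (\<gamma> x) = \<gamma> x"
  using gamma_decomposition[of x] gamma_invariant by metis

lemma gamma_inner_self: "\<gamma> x \<bullet> \<gamma> x = x \<bullet> x"
  using gamma_decomposition[of x] inner_blinfun_apply by metis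

lemma inner_gamma_image_le:
  assumes "A \<in> G"
  shows "blinfun_apply A (\<gamma> x) \<bullet> w \<le> \<gamma> x \<bullet> \<gamma> w"
  using gamma_inner[of "blinfun_apply A (\<gamma> x)" w] assms
  by (simp add: gamma_invariant gamma_idem)

text \<open>Take \<open>B\<close> as \<open>A\<close> times the inverse of a \<open>C\<close> that
  decomposes \<open>x\<close>. Thus \<open>A (\<gamma> x)\<close> lies in the orbit of
  \<open>x\<close>.\<close>

lemma blinfun_apply_transitive_on_gamma_fibre:
  assumes "A \<in> G"
  shows "\<exists>B\<in>G. blinfun_apply B x = blinfun_apply A (\<gamma> x)"
proof -
  interpret O: group "orthogonal_group :: ('a \<Rightarrow>\<^sub>L 'a) monoid"
    by (rule group_orthogonal_group)
  obtain C where C: "C \<in> G" "x = blinfun_apply C (\<gamma> x)"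
    using gamma_decomposition by blast
  let ?C' = "inv\<^bsub>orthogonal_group\<^esub> C"
  have "?C' \<otimes>\<^bsub>orthogonal_group\<^esub> C = \<one>\<^bsub>orthogonal_group\<^esub>"
    using C(1) subgroup.mem_carrier[OF subgroup_orthogonal] by simp
  then have "?C' o\<^sub>L C = id_blinfun"
    by (simp add: orthogonal_group_def)
  then have "blinfun_apply ?C' x = \<gamma> x"
    using C(2) by (metis blinfun_apply_blinfun_compose blinfun_apply_id_blinfun id_apply)
  moreover have "A \<otimes>\<^bsub>orthogonal_group\<^esub> ?C' \<in> G"
    using assms C(1) subgroup_orthogonal
    by (simp add: subgroup.m_closed subgroup.m_inv_closed)
  then have "A o\<^sub>L ?C' \<in> G"
    by (simp add: orthogonal_group_def)
  ultimately show ?thesis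
    by (intro bexI[of _ "A o\<^sub>L ?C'"]) simp_all
qed

text \<open>Both sides have the same norm since \<open>\<gamma>\<close> preserves norms and, by
  assumption, the cross term. Adding \<open>gamma_inner\<close> for the pairs \<open>x + w\<close>,
  \<open>x\<close> and \<open>x + w\<close>, \<open>w\<close> gives the inequality needed for
  equality.\<close>

lemma gamma_add_if_inner_eq:
  assumes "x \<bullet> w = \<gamma> x \<bullet> \<gamma> w"
  shows "\<gamma> (x + w) = \<gamma> x + \<gamma> w"
proof (rule eq_if_inner_ge)
  show "\<gamma> (x + w) \<bullet> \<gamma> (x + w) = (\<gamma> x + \<gamma> w) \<bullet> (\<gamma> x + \<gamma> w)"
    using assms gamma_inner_self[of "x + w"] gamma_inner_self[of x] gamma_inner_self[of w]
    by (simp add: inner_add inner_commute)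
  show "\<gamma> (x + w) \<bullet> \<gamma> (x + w) \<le> \<gamma> (x + w) \<bullet> (\<gamma> x + \<gamma> w)"
    using gamma_inner[of "x + w" x] gamma_inner[of "x + w" w]
    by (simp add: gamma_inner_self inner_add_right)
qed

theorem commute_if_inner_eq:
  assumes eq: "x \<bullet> w = \<gamma> x \<bullet> \<gamma> w"
  shows "commute_in G \<gamma> x w"
proof -
  obtain A where A: "A \<in> G" "x + w = blinfun_apply A (\<gamma> (x + w))"
    using gamma_decomposition by blast
  let ?x = "blinfun_apply A (\<gamma> x)" and ?w = "blinfun_apply A (\<gamma> w)"
  have sum: "x + w = ?x + ?w"
    using A(2) by (simp add: gamma_add_if_inner_eq[OF eq] blinfun.add_right)
  have "x = ?x"
  proof (rule eq_if_inner_ge)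
    show "x \<bullet> x = ?x \<bullet> ?x"
      using A(1) by (simp add: inner_blinfun_apply gamma_inner_self)
    \<comment> \<open>As \<open>x + w = ?x + ?w\<close>, an upper bound on
      \<open>?w \<bullet> x\<close> is a lower bound on \<open>?x \<bullet> x\<close>.\<close>
    have "?w \<bullet> x \<le> w \<bullet> x"
      using inner_gamma_image_le[OF A(1), of w x] eq by (simp add: inner_commute)
    moreover have "x \<bullet> x + w \<bullet> x = ?x \<bullet> x + ?w \<bullet> x"
      using sum by (metis inner_add_left)
    ultimately show "x \<bullet> x \<le> x \<bullet> ?x"
      by (simp add: inner_commute)
  qed
  moreover from this sum have "w = ?w"
    by (metis add_left_cancel)
  ultimately show ?thesis
    using A(1) unfolding commute_in_def by blast
qed

lemma commute_if_maximal_on_orbit: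
  assumes "\<And>B. B \<in> G \<Longrightarrow> v \<bullet> blinfun_apply B a \<le> v \<bullet> a"
  shows "commute_in G \<gamma> v a"
proof (rule commute_if_inner_eq)
  obtain A where A: "A \<in> G" "v = blinfun_apply A (\<gamma> v)"
    using gamma_decomposition by blast
  \<comment> \<open>The orbit point \<open>A (\<gamma> a)\<close> attains the upper bound
    \<open>\<gamma> v \<bullet> \<gamma> a\<close>, because the same \<open>A\<close> carries
    \<open>\<gamma> v\<close> to \<open>v\<close>.\<close>
  obtain B where B: "B \<in> G" "blinfun_apply B a = blinfun_apply A (\<gamma> a)"
    using blinfun_apply_transitive_on_gamma_fibre[OF A(1)] by blast
  have "\<gamma> v \<bullet> \<gamma> a = v \<bullet> blinfun_apply B a"
    using A B(2) by (metis inner_blinfun_apply)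
  then show "v \<bullet> a = \<gamma> v \<bullet> \<gamma> a"
    using assms[OF B(1)] gamma_inner[of v a] by simp
qed

end

theorem theorem3:
  fixes G :: "('a::real_inner \<Rightarrow>\<^sub>L 'a) set"
    and \<gamma> :: "'a \<Rightarrow> 'a"
    and \<Omega> :: "'a set"
    and F \<Theta> :: "'a \<Rightarrow> real"
    and a \<Theta>'a :: 'a
  assumes "normal_decomposition_system G \<gamma>"
    and "convex \<Omega>" and "invariant_set G \<Omega>"
    and "convex_on UNIV F" and "invariant_fun G F"
    and "\<forall>x. \<Theta> differentiable (at x)"
    and "GDERIV \<Theta> a :> \<Theta>'a"
    and "local_minimizer_on \<Omega> (\<lambda>x. \<Theta> x + F x) a"
  shows "commute_in G \<gamma> (- \<Theta>'a) a"
proof -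
  interpret normal_decomposition_system G \<gamma>
    by fact
  obtain N where a: "a \<in> \<Omega>" and N: "open N" "a \<in> N"
    and min: "\<And>x. x \<in> N \<inter> \<Omega> \<Longrightarrow> \<Theta> a + F a \<le> \<Theta> x + F x"
    using assms(8) unfolding local_minimizer_on_def by blast
  show ?thesis
  proof (rule commute_if_maximal_on_orbit)
    fix B
    assume B: "B \<in> G"
    let ?b = "blinfun_apply B a"
    have b: "?b \<in> \<Omega>" and Fb: "F ?b = F a"
      using assms(3,5) B a by (auto simp: invariant_set_def invariant_fun_def)
    have "0 \<le> \<Theta>'a \<bullet> (?b - a)"
    proof (rule GDERIV_nonneg_if_local_min_on_segment[OF assms(7) N])
      fix t :: real
      assume t: "0 < t" "t \<le> 1" and in_N: "a + t *\<^sub>R (?b - a) \<in> N"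
      have seg: "a + t *\<^sub>R (?b - a) = (1 - t) *\<^sub>R a + t *\<^sub>R ?b"
        by (simp add: algebra_simps)
      have "F (a + t *\<^sub>R (?b - a)) \<le> (1 - t) * F a + t * F ?b"
        unfolding seg using t by (intro convex_onD[OF assms(4)]) auto
      also have "\<dots> = F a"
        by (simp add: Fb algebra_simps)
      finally have "F (a + t *\<^sub>R (?b - a)) \<le> F a" .
      moreover have "a + t *\<^sub>R (?b - a) \<in> \<Omega>"
        unfolding seg using t a b by (intro convexD[OF assms(2)]) auto
      \<comment> \<open>Since \<open>F\<close> does not exceed \<open>F a\<close> on the segment,
        local minimality of the sum passes to \<open>\<Theta>\<close> alone.\<close>
      ultimately show "\<Theta> a \<le> \<Theta> (a + t *\<^sub>R (?b - a))"
        using min[of "a + t *\<^sub>R (?b - a)"] in_N by simp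
    qed
    then show "- \<Theta>'a \<bullet> ?b \<le> - \<Theta>'a \<bullet> a"
      by (simp add: inner_diff_right)
  qed
qed

end
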